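(* Let $G$ be a connected finite-dimensional Lie group with Lie algebra $\mathfrak{g}$, $M$ a smooth connected manifold, $h\colon G\times M\to M$ a smooth transitive right action, and $y_0\in M$. Consider the left invariant system $\dot X = Xu$ on $G$ with complementary output $y=h(X,y_0)$. Two states $X,Y\in G$ are indistinguishable if and only if $XY^{-1}\in\operatorname{stab}(y_0)$. In particular, a state $X\in G$ is indistinguishable from the identity of $G$ if and only if $X\in\operatorname{stab}(y_0)$.
   Context: Right action means $h(X,h(Y,y))=h(YX,y)$ for all $X,Y\in G$, $y\in M$. For $X\in G$, $u\in\mathfrak{g}$, $Xu := T_eL_Xu\in T_XG$ with $L_X$ left multiplication. $\operatorname{stab}(y_0)=\{X\in G\mid h(X,y_0)=y_0\}$. An input $u\colon\mathbb{R}\to\mathfrak{g}$ is admissible if the time-variant differential equation $\dot X=Xu(t)$ has unique solutions for all initial values. Two states $X,Y\in G$ are indistinguishable if for every admissible input $u$ the solutions $X(t)$, $Y(t)$ of $\dot X=Xu$ with $X(0)=X$ and $Y(0)=Y$ produce the same output: $h(X(t),y_0)=h(Y(t),y_0)$ for all $t$. *)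

theory Defs
  imports "HOL-Analysis.Analysis" "HOL-Algebra.Group_Action"
begin

text \<open>
  Only used for open \<open>S\<close> in a finite-dimensional space, where \<open>f\<close> is \<open>C\<^sup>k\<^sup>+\<^sup>1\<close> iff \<open>f\<close> is
  differentiable and every directional derivative \<open>x \<mapsto> Df(x) v\<close> is \<open>C\<^sup>k\<close>.
\<close>

primrec Ck_on ::
  "nat \<Rightarrow> 'a::real_normed_vector set \<Rightarrow> ('a \<Rightarrow> 'b::real_normed_vector) \<Rightarrow> bool" where
  "Ck_on 0 S f \<longleftrightarrow> continuous_on S f"
| "Ck_on (Suc k) S f \<longleftrightarrow>
     (\<forall>x\<in>S. f differentiable (at x)) \<and>
     (\<forall>v. Ck_on k S (\<lambda>x. frechet_derivative f (at x) v))"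

definition smooth_on ::
  "'a::real_normed_vector set \<Rightarrow> ('a \<Rightarrow> 'b::real_normed_vector) \<Rightarrow> bool" where
  "smooth_on S f \<longleftrightarrow> (\<forall>k. Ck_on k S f)"

text \<open>
  A chart \<open>(U, \<phi>)\<close> consists of its domain and its coordinate map; the values of \<open>\<phi>\<close> outside
  \<open>U\<close> are irrelevant.  The model space \<open>'e\<close> is a finite-dimensional real normed space rather
  than a type of class \<open>euclidean_space\<close>, because the latter excludes dimension 0.
\<close>

type_synonym ('a, 'e) chart = "'a set \<times> ('a \<Rightarrow> 'e)"

record ('a, 'e) manifold =
  mtop :: "'a topology"
  atlas :: "('a, 'e) chart set"

abbreviation chart_inv :: "('a, 'e) chart \<Rightarrow> 'e \<Rightarrow> 'a" where
  "chart_inv c \<equiv> inv_into (fst c) (snd c)"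

definition is_chart :: "'a topology \<Rightarrow> ('a, 'e::real_normed_vector) chart \<Rightarrow> bool" where
  "is_chart T c \<longleftrightarrow>
     openin T (fst c) \<and> open (snd c ` fst c) \<and>
     homeomorphic_map (subtopology T (fst c)) (top_of_set (snd c ` fst c)) (snd c)"

text \<open>
  The atlas is any smooth atlas; it need not be maximal, since it determines a unique
  maximal one, and all notions below are unchanged when compatible charts are added.
\<close>

locale smooth_manifold =
  fixes M :: "('a, 'e::real_normed_vector) manifold"
  assumes finite_dimensional: "\<exists>B::'e set. finite B \<and> span B = UNIV"
    and Hausdorff: "Hausdorff_space (mtop M)"
    and second_countable: "second_countable (mtop M)"
    and charts: "\<And>c. c \<in> atlas M \<Longrightarrow> is_chart (mtop M) c"
    and covering: "(\<Union>c\<in>atlas M. fst c) = topspace (mtop M)"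
    and compatible: "\<And>c d. c \<in> atlas M \<Longrightarrow> d \<in> atlas M \<Longrightarrow>
      smooth_on (snd c ` (fst c \<inter> fst d)) (snd d \<circ> chart_inv c)"

definition smooth_map ::
  "('a, 'e::real_normed_vector) manifold \<Rightarrow> ('b, 'f::real_normed_vector) manifold \<Rightarrow>
   ('a \<Rightarrow> 'b) \<Rightarrow> bool" where
  "smooth_map M N f \<longleftrightarrow>
     continuous_map (mtop M) (mtop N) f \<and>
     (\<forall>c\<in>atlas M. \<forall>d\<in>atlas N.
        smooth_on (snd c ` (fst c \<inter> f -` fst d)) (snd d \<circ> f \<circ> chart_inv c))"

definition prod_manifold ::
  "('a, 'e) manifold \<Rightarrow> ('b, 'f) manifold \<Rightarrow> ('a \<times> 'b, 'e \<times> 'f) manifold" where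
  "prod_manifold M N =
     \<lparr>mtop = prod_topology (mtop M) (mtop N),
      atlas = {(fst c \<times> fst d, map_prod (snd c) (snd d)) | c d. c \<in> atlas M \<and> d \<in> atlas N}\<rparr>"

definition charts_at :: "('a, 'e) manifold \<Rightarrow> 'a \<Rightarrow> ('a, 'e) chart set" where
  "charts_at M p = {c \<in> atlas M. p \<in> fst c}"

text \<open>
  A tangent vector at \<open>p\<close> is the family of its coordinate representations, one for each chart
  around \<open>p\<close>, which are related by the derivatives of the coordinate changes.
\<close>

definition tangent_space ::
  "('a, 'e::real_normed_vector) manifold \<Rightarrow> 'a \<Rightarrow> (('a, 'e) chart \<Rightarrow> 'e) set" where
  "tangent_space M p =
     {v \<in> extensional (charts_at M p).
        \<forall>c\<in>charts_at M p. \<forall>d\<in>charts_at M p.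
          v d = frechet_derivative (snd d \<circ> chart_inv c) (at (snd c p)) (v c)}"

text \<open>
  The tangent map \<open>T\<^sub>p f\<close>.  By the chain rule the result does not depend on the choice of the
  chart \<open>c\<close> around \<open>p\<close>.
\<close>

definition tangent_map ::
  "('a, 'e::real_normed_vector) manifold \<Rightarrow> ('b, 'f::real_normed_vector) manifold \<Rightarrow>
   ('a \<Rightarrow> 'b) \<Rightarrow> 'a \<Rightarrow> (('a, 'e) chart \<Rightarrow> 'e) \<Rightarrow> (('b, 'f) chart \<Rightarrow> 'f)" where
  "tangent_map M N f p v =
     (let c = (SOME c. c \<in> charts_at M p) in
      restrict (\<lambda>d. frechet_derivative (snd d \<circ> f \<circ> chart_inv c) (at (snd c p)) (v c))
        (charts_at N (f p)))"

definition has_velocity ::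
  "('a, 'e::real_normed_vector) manifold \<Rightarrow> (real \<Rightarrow> 'a) \<Rightarrow> (('a, 'e) chart \<Rightarrow> 'e) \<Rightarrow> real \<Rightarrow> bool"
  where
  "has_velocity M \<gamma> v t \<longleftrightarrow>
     v \<in> tangent_space M (\<gamma> t) \<and>
     limitin (mtop M) \<gamma> (\<gamma> t) (at t) \<and>
     (\<forall>c\<in>charts_at M (\<gamma> t). ((snd c \<circ> \<gamma>) has_vector_derivative v c) (at t))"

locale lie_group = group G + smooth_manifold L
  for G :: "('g, 'z) monoid_scheme" (structure)
    and L :: "('g, 'e::real_normed_vector) manifold" +
  assumes carrier_eq: "topspace (mtop L) = carrier G"
    and smooth_mult: "smooth_map (prod_manifold L L) L (\<lambda>(X, Y). X \<otimes> Y)"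
    and smooth_inverse: "smooth_map L L (\<lambda>X. inv X)"

locale smooth_transitive_right_action = lie_group G L + smooth_manifold M
  for G :: "('g, 'z) monoid_scheme" (structure)
    and L :: "('g, 'e::real_normed_vector) manifold"
    and M :: "('m, 'f::real_normed_vector) manifold" +
  fixes h :: "'g \<Rightarrow> 'm \<Rightarrow> 'm"
  assumes smooth_action: "smooth_map (prod_manifold L M) M (\<lambda>(X, y). h X y)"
    and action_one: "\<And>y. y \<in> topspace (mtop M) \<Longrightarrow> h \<one> y = y"
    and action_mult: "\<And>X Y y. X \<in> carrier G \<Longrightarrow> Y \<in> carrier G \<Longrightarrow> y \<in> topspace (mtop M) \<Longrightarrow>
      h X (h Y y) = h (Y \<otimes> X) y"
    and transitive: "\<And>y z. y \<in> topspace (mtop M) \<Longrightarrow> z \<in> topspace (mtop M) \<Longrightarrow>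
      \<exists>X\<in>carrier G. h X y = z"

text \<open>
  The space underlying the Lie algebra is the tangent space at the identity; the bracket plays no
  role for the system.
\<close>

definition lie_algebra ::
  "('g, 'z) monoid_scheme \<Rightarrow> ('g, 'e::real_normed_vector) manifold \<Rightarrow> (('g, 'e) chart \<Rightarrow> 'e) set"
  where
  "lie_algebra G L = tangent_space L \<one>\<^bsub>G\<^esub>"

text \<open>The vector \<open>X u = T\<^sub>e L\<^sub>X u\<close> in the tangent space at \<open>X\<close>.\<close>

definition left_translate ::
  "('g, 'z) monoid_scheme \<Rightarrow> ('g, 'e::real_normed_vector) manifold \<Rightarrow> 'g \<Rightarrow>
   (('g, 'e) chart \<Rightarrow> 'e) \<Rightarrow> (('g, 'e) chart \<Rightarrow> 'e)" where
  "left_translate G L X u = tangent_map L L (\<lambda>Z. X \<otimes>\<^bsub>G\<^esub> Z) \<one>\<^bsub>G\<^esub> u"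

definition is_solution ::
  "('g, 'z) monoid_scheme \<Rightarrow> ('g, 'e::real_normed_vector) manifold \<Rightarrow>
   (real \<Rightarrow> ('g, 'e) chart \<Rightarrow> 'e) \<Rightarrow> (real \<Rightarrow> 'g) \<Rightarrow> bool" where
  "is_solution G L u \<gamma> \<longleftrightarrow>
     (\<forall>t. \<gamma> t \<in> carrier G \<and> has_velocity L \<gamma> (left_translate G L (\<gamma> t) (u t)) t)"

definition admissible ::
  "('g, 'z) monoid_scheme \<Rightarrow> ('g, 'e::real_normed_vector) manifold \<Rightarrow>
   (real \<Rightarrow> ('g, 'e) chart \<Rightarrow> 'e) \<Rightarrow> bool" where
  "admissible G L u \<longleftrightarrow>
     (\<forall>t. u t \<in> lie_algebra G L) \<and>
     (\<forall>t\<^sub>0. \<forall>X\<^sub>0\<in>carrier G. \<exists>!\<gamma>. is_solution G L u \<gamma> \<and> \<gamma> t\<^sub>0 = X\<^sub>0)"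

definition indistinguishable ::
  "('g, 'z) monoid_scheme \<Rightarrow> ('g, 'e::real_normed_vector) manifold \<Rightarrow> ('g \<Rightarrow> 'm \<Rightarrow> 'm) \<Rightarrow> 'm \<Rightarrow>
   'g \<Rightarrow> 'g \<Rightarrow> bool" where
  "indistinguishable G L h y\<^sub>0 X Y \<longleftrightarrow>
     (\<forall>u \<gamma> \<delta>. admissible G L u \<longrightarrow>
        is_solution G L u \<gamma> \<longrightarrow> \<gamma> 0 = X \<longrightarrow>
        is_solution G L u \<delta> \<longrightarrow> \<delta> 0 = Y \<longrightarrow>
        (\<forall>t. h (\<gamma> t) y\<^sub>0 = h (\<delta> t) y\<^sub>0))"

end

theory Submission
  imports Defs
begin

text \<open>
  Left translations are symmetries of the system: if \<open>\<delta>\<close> solves \<open>\<delta>' = \<delta> u\<close>, then so does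
  \<open>t \<mapsto> Z \<delta>(t)\<close>, because \<open>T L\<^sub>Z (T L\<^sub>X u) = T L\<^bsub>Z X\<^esub> u\<close> by the chain rule
  (\<open>is_solution_left_translation\<close>).  By uniqueness, the solutions starting at \<open>X\<close> and \<open>Y\<close> are
  therefore related by \<open>\<gamma>(t) = X Y\<^sup>-\<^sup>1 \<delta>(t)\<close>.  For a right action this gives
  \<open>h(\<gamma>(t), y\<^sub>0) = h(\<delta>(t), h(X Y\<^sup>-\<^sup>1, y\<^sub>0))\<close>, so the outputs agree when
  \<open>X Y\<^sup>-\<^sup>1\<close> stabilizes \<open>y\<^sub>0\<close>.

  Conversely, a single input detects whether \<open>X Y\<^sup>-\<^sup>1\<close> stabilizes \<open>y\<^sub>0\<close>.  The zero input is
  admissible, with constant solutions (\<open>admissible_zero\<close>): a curve of zero velocity is locally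
  constant in charts and hence constant (\<open>zero_velocity_imp_constant\<close>).  Indistinguishability
  under this input says \<open>h(X, y\<^sub>0) = h(Y, y\<^sub>0)\<close>, and acting by \<open>Y\<^sup>-\<^sup>1\<close> turns this into
  \<open>h(X Y\<^sup>-\<^sup>1, y\<^sub>0) = y\<^sub>0\<close>.

  All the calculus involved is of first order, so it is carried out for maps whose coordinate
  representations are merely differentiable; this makes restricting the multiplication to a slice
  \<open>{Z} \<times> G\<close> a matter of one chain rule.
\<close>

section \<open>Charts\<close>

lemma is_chart_inj_on: "is_chart T c \<Longrightarrow> inj_on (snd c) (fst c)"
  unfolding is_chart_def
  using homeomorphic_imp_injective_map openin_subset
  by (metis inf.absorb_iff2 topspace_subtopology)

lemma is_chart_open_image:
  assumes "is_chart T c" "openin T W"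
  shows "open (snd c ` (fst c \<inter> W))"
proof -
  have op: "openin T (fst c)" "open (snd c ` fst c)"
    and hom: "homeomorphic_map (subtopology T (fst c)) (top_of_set (snd c ` fst c)) (snd c)"
    using assms by (auto simp: is_chart_def)
  have "openin (subtopology T (fst c)) (fst c \<inter> W)"
    using assms(2) by (metis Int_commute openin_subtopology)
  then have "openin (top_of_set (snd c ` fst c)) (snd c ` (fst c \<inter> W))"
    using homeomorphic_imp_open_map[OF hom] by (auto simp: open_map_def)
  then show ?thesis
    using op(2) openin_open_trans by blast
qed

lemma is_chart_inv: "is_chart T c \<Longrightarrow> p \<in> fst c \<Longrightarrow> chart_inv c (snd c p) = p"
  by (simp add: is_chart_inj_on)

context smooth_manifold
begin

lemma charts_at_is_chart: "c \<in> charts_at M p \<Longrightarrow> is_chart (mtop M) c"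
  by (simp add: charts_at_def charts)

lemma charts_at_mem: "c \<in> charts_at M p \<Longrightarrow> p \<in> fst c"
  by (simp add: charts_at_def)

lemma charts_at_inv: "c \<in> charts_at M p \<Longrightarrow> chart_inv c (snd c p) = p"
  by (rule is_chart_inv[OF charts_at_is_chart charts_at_mem])

lemma charts_at_openin: "c \<in> charts_at M p \<Longrightarrow> openin (mtop M) (fst c)"
  using charts_at_is_chart[of c p] by (simp add: is_chart_def)

lemma charts_at_subset: "c \<in> charts_at M p \<Longrightarrow> fst c \<subseteq> topspace (mtop M)"
  by (rule openin_subset[OF charts_at_openin])

lemma charts_at_nonempty:
  assumes "p \<in> topspace (mtop M)"
  shows "\<exists>c. c \<in> charts_at M p"
proof -
  have "p \<in> (\<Union>c\<in>atlas M. fst c)"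
    using assms unfolding covering .
  then show ?thesis
    unfolding charts_at_def by blast
qed

end

section \<open>Differentiable maps and their tangent maps\<close>

definition differentiable_map ::
  "('a, 'e::real_normed_vector) manifold \<Rightarrow> ('b, 'f::real_normed_vector) manifold \<Rightarrow>
   ('a \<Rightarrow> 'b) \<Rightarrow> bool" where
  "differentiable_map M N f \<longleftrightarrow>
     continuous_map (mtop M) (mtop N) f \<and>
     (\<forall>p. \<forall>c\<in>charts_at M p. \<forall>d\<in>charts_at N (f p).
        (snd d \<circ> f \<circ> chart_inv c) differentiable (at (snd c p)))"

lemma differentiable_mapD:
  "differentiable_map M N f \<Longrightarrow> c \<in> charts_at M p \<Longrightarrow> d \<in> charts_at N (f p) \<Longrightarrow>
   (snd d \<circ> f \<circ> chart_inv c) differentiable (at (snd c p))"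
  by (auto simp: differentiable_map_def)

lemma differentiable_map_continuous:
  "differentiable_map M N f \<Longrightarrow> continuous_map (mtop M) (mtop N) f"
  by (auto simp: differentiable_map_def)

lemma smooth_on_differentiable:
  "smooth_on S f \<Longrightarrow> x \<in> S \<Longrightarrow> f differentiable (at x)"
  unfolding smooth_on_def using Ck_on.simps(2)[of 0 S f] by blast

lemma (in smooth_manifold) differentiable_map_ident: "differentiable_map M M (\<lambda>p. p)"
proof -
  have "(snd d \<circ> (\<lambda>p. p) \<circ> chart_inv c) differentiable (at (snd c p))"
    if "c \<in> charts_at M p" "d \<in> charts_at M p" for c d p
    using smooth_on_differentiable[OF compatible[of c d], of "snd c p"] that
    by (auto simp: charts_at_def comp_def)
  then show ?thesis
    by (auto simp: differentiable_map_def)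
qed

text \<open>
  The third map \<open>k\<close> stands for the composition because two maps that agree only on the underlying
  set of the manifold are different functions: \<open>Y \<mapsto> Z (X Y)\<close> and \<open>Y \<mapsto> (Z X) Y\<close> agree only on the
  carrier of the group.
\<close>

lemma coordinate_chain_rule:
  assumes M: "smooth_manifold M" and N: "smooth_manifold N"
    and f: "differentiable_map M N f" and g: "differentiable_map N P g"
    and k: "\<And>x. x \<in> topspace (mtop M) \<Longrightarrow> k x = g (f x)"
    and c: "c \<in> charts_at M p" and d: "d \<in> charts_at N (f p)" and e: "e \<in> charts_at P (k p)"
  shows "frechet_derivative (snd e \<circ> k \<circ> chart_inv c) (at (snd c p)) v =
         frechet_derivative (snd e \<circ> g \<circ> chart_inv d) (at (snd d (f p)))
           (frechet_derivative (snd d \<circ> f \<circ> chart_inv c) (at (snd c p)) v)"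
proof -
  interpret M: smooth_manifold M by fact
  interpret N: smooth_manifold N by fact
  define F where "F = snd d \<circ> f \<circ> chart_inv c"
  define K where "K = snd e \<circ> g \<circ> chart_inv d"
  have p: "p \<in> topspace (mtop M)" "p \<in> fst c"
    using M.charts_at_subset[OF c] M.charts_at_mem[OF c] by auto
  have Fp: "F (snd c p) = snd d (f p)"
    by (simp add: F_def M.charts_at_inv[OF c])
  have F: "(F has_derivative frechet_derivative F (at (snd c p))) (at (snd c p))"
    unfolding F_def by (rule frechet_derivative_works[THEN iffD1, OF differentiable_mapD[OF f c d]])
  have e': "e \<in> charts_at P (g (f p))"
    using e k[OF p(1)] by simp
  have "(K has_derivative frechet_derivative K (at (snd d (f p)))) (at (snd d (f p)))"
    unfolding K_def by (rule frechet_derivative_works[THEN iffD1, OF differentiable_mapD[OF g d e']])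
  then have KF: "(K \<circ> F has_derivative
      frechet_derivative K (at (snd d (f p))) \<circ> frechet_derivative F (at (snd c p))) (at (snd c p))"
    by (rule diff_chain_at[OF F, unfolded Fp])
  define W where "W = {x \<in> topspace (mtop M). f x \<in> fst d}"
  have "openin (mtop M) W"
    unfolding W_def
    by (rule openin_continuous_map_preimage[OF differentiable_map_continuous[OF f]
          N.charts_at_openin[OF d]])
  then have opn: "open (snd c ` (fst c \<inter> W))"
    using is_chart_open_image M.charts_at_is_chart[OF c] by blast
  have mem: "snd c p \<in> snd c ` (fst c \<inter> W)"
    using p N.charts_at_mem[OF d] by (auto simp: W_def)
  have eq: "(K \<circ> F) x = (snd e \<circ> k \<circ> chart_inv c) x" if x: "x \<in> snd c ` (fst c \<inter> W)" for x
  proof -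
    obtain q where q: "q \<in> fst c" "q \<in> W" "x = snd c q"
      using x by blast
    have "chart_inv d (snd d (f q)) = f q"
      using q(2) is_chart_inv[OF N.charts_at_is_chart[OF d]] by (simp add: W_def)
    then show ?thesis
      using q is_chart_inv[OF M.charts_at_is_chart[OF c] q(1)]
      by (simp add: K_def F_def W_def k)
  qed
  have "(snd e \<circ> k \<circ> chart_inv c has_derivative
      frechet_derivative K (at (snd d (f p))) \<circ> frechet_derivative F (at (snd c p))) (at (snd c p))"
    by (rule has_derivative_transform_within_open[OF KF opn mem eq])
  from frechet_derivative_at[OF this, symmetric] show ?thesis
    unfolding K_def F_def by (simp only: comp_apply)
qed

text \<open>
  By definition, the tangent map is computed in an arbitrarily chosen chart; for a vector in the tangent space
  every chart gives the same result.
\<close>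

lemma tangent_map_apply:
  assumes M: "smooth_manifold M" and f: "differentiable_map M N f"
    and v: "v \<in> tangent_space M p"
    and c: "c \<in> charts_at M p" and d: "d \<in> charts_at N (f p)"
  shows "tangent_map M N f p v d =
         frechet_derivative (snd d \<circ> f \<circ> chart_inv c) (at (snd c p)) (v c)"
proof -
  interpret M: smooth_manifold M by fact
  define b where "b = (SOME c. c \<in> charts_at M p)"
  have b: "b \<in> charts_at M p"
    unfolding b_def using c by (rule someI)
  have "tangent_map M N f p v d = frechet_derivative (snd d \<circ> f \<circ> chart_inv b) (at (snd b p)) (v b)"
    unfolding tangent_map_def Let_def b_def[symmetric] using d by (rule restrict_apply')
  also have "\<dots> =
        frechet_derivative (snd d \<circ> f \<circ> chart_inv c) (at (snd c p))
          (frechet_derivative (snd c \<circ> (\<lambda>p. p) \<circ> chart_inv b) (at (snd b p)) (v b))"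
    by (rule coordinate_chain_rule[OF M M M.differentiable_map_ident f]) (simp_all add: b c d)
  also have "frechet_derivative (snd c \<circ> (\<lambda>p. p) \<circ> chart_inv b) (at (snd b p)) (v b) = v c"
  proof -
    have "v c = frechet_derivative (snd c \<circ> chart_inv b) (at (snd b p)) (v b)"
      using v b c unfolding tangent_space_def by blast
    then show ?thesis
      by (simp add: comp_def)
  qed
  finally show ?thesis .
qed

lemma tangent_map_in_tangent_space:
  assumes M: "smooth_manifold M" and N: "smooth_manifold N" and f: "differentiable_map M N f"
    and v: "v \<in> tangent_space M p" and p: "p \<in> topspace (mtop M)"
  shows "tangent_map M N f p v \<in> tangent_space N (f p)"
proof -
  interpret M: smooth_manifold M by fact
  interpret N: smooth_manifold N by fact
  obtain c where c: "c \<in> charts_at M p"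
    using M.charts_at_nonempty[OF p] by blast
  show ?thesis
    unfolding tangent_space_def
  proof (intro CollectI conjI ballI)
    show "tangent_map M N f p v \<in> extensional (charts_at N (f p))"
      by (simp add: tangent_map_def Let_def)
  next
    fix d e
    assume d: "d \<in> charts_at N (f p)" and e: "e \<in> charts_at N (f p)"
    have ident: "snd e \<circ> (\<lambda>q. q) \<circ> chart_inv d = snd e \<circ> chart_inv d"
      by (simp add: comp_def)
    have "frechet_derivative (snd e \<circ> f \<circ> chart_inv c) (at (snd c p)) (v c) =
          frechet_derivative (snd e \<circ> (\<lambda>q. q) \<circ> chart_inv d) (at (snd d (f p)))
            (frechet_derivative (snd d \<circ> f \<circ> chart_inv c) (at (snd c p)) (v c))"
      by (rule coordinate_chain_rule[OF M N f N.differentiable_map_ident, where k = f, OF refl c d e])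
    then show "tangent_map M N f p v e =
        frechet_derivative (snd e \<circ> chart_inv d) (at (snd d (f p))) (tangent_map M N f p v d)"
      unfolding ident tangent_map_apply[OF M f v c d] tangent_map_apply[OF M f v c e] .
  qed
qed

lemma tangent_map_compose:
  assumes M: "smooth_manifold M" and N: "smooth_manifold N"
    and f: "differentiable_map M N f" and g: "differentiable_map N P g"
    and kd: "differentiable_map M P k"
    and k: "\<And>x. x \<in> topspace (mtop M) \<Longrightarrow> k x = g (f x)"
    and v: "v \<in> tangent_space M p" and p: "p \<in> topspace (mtop M)"
  shows "tangent_map M P k p v = tangent_map N P g (f p) (tangent_map M N f p v)"
proof
  fix e
  interpret M: smooth_manifold M by fact
  interpret N: smooth_manifold N by fact
  have w: "tangent_map M N f p v \<in> tangent_space N (f p)"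
    by (rule tangent_map_in_tangent_space[OF M N f v p])
  have fp: "f p \<in> topspace (mtop N)"
    using differentiable_map_continuous[OF f] p by (auto simp: continuous_map_def)
  obtain c d where c: "c \<in> charts_at M p" and d: "d \<in> charts_at N (f p)"
    using M.charts_at_nonempty[OF p] N.charts_at_nonempty[OF fp] by blast
  show "tangent_map M P k p v e = tangent_map N P g (f p) (tangent_map M N f p v) e"
  proof (cases "e \<in> charts_at P (k p)")
    case True
    then have e: "e \<in> charts_at P (g (f p))"
      by (simp add: k p)
    show ?thesis
      using coordinate_chain_rule[OF M N f g k c d True]
      by (simp add: tangent_map_apply[OF M kd v c True] tangent_map_apply[OF N g w d e]
          tangent_map_apply[OF M f v c d])
  next
    case False
    then show ?thesis
      by (simp add: tangent_map_def Let_def k p)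
  qed
qed

lemma has_velocity_map:
  assumes M: "smooth_manifold M" and N: "smooth_manifold N" and f: "differentiable_map M N f"
    and vel: "has_velocity M \<gamma> v t"
  shows "has_velocity N (\<lambda>s. f (\<gamma> s)) (tangent_map M N f (\<gamma> t) v) t"
proof -
  interpret M: smooth_manifold M by fact
  have v: "v \<in> tangent_space M (\<gamma> t)" and lim: "limitin (mtop M) \<gamma> (\<gamma> t) (at t)"
    using vel by (auto simp: has_velocity_def)
  have p: "\<gamma> t \<in> topspace (mtop M)"
    using lim by (rule limitin_topspace)
  obtain c where c: "c \<in> charts_at M (\<gamma> t)"
    using M.charts_at_nonempty[OF p] by blast
  have "limitin (mtop N) (\<lambda>s. f (\<gamma> s)) (f (\<gamma> t)) (at t)"
    using continuous_map_limit[OF differentiable_map_continuous[OF f] lim] by (simp add: comp_def)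
  moreover have "((snd d \<circ> (\<lambda>s. f (\<gamma> s))) has_vector_derivative tangent_map M N f (\<gamma> t) v d) (at t)"
    if d: "d \<in> charts_at N (f (\<gamma> t))" for d
  proof -
    define F where "F = snd d \<circ> f \<circ> chart_inv c"
    define F' where "F' = frechet_derivative F (at (snd c (\<gamma> t)))"
    have F: "(F has_derivative F') (at ((snd c \<circ> \<gamma>) t))"
      using frechet_derivative_works[THEN iffD1, OF differentiable_mapD[OF f c d]]
      unfolding F_def F'_def comp_apply .
    have "((snd c \<circ> \<gamma>) has_vector_derivative v c) (at t)"
      using vel c by (auto simp: has_velocity_def)
    then have "(F \<circ> (snd c \<circ> \<gamma>) has_derivative F' \<circ> (\<lambda>x. x *\<^sub>R v c)) (at t)"
      unfolding has_vector_derivative_def using F by (rule diff_chain_at)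
    moreover have "F' \<circ> (\<lambda>x. x *\<^sub>R v c) = (\<lambda>x. x *\<^sub>R F' (v c))"
      using has_derivative_linear[OF F] by (auto simp: linear_scale)
    ultimately have D: "(F \<circ> (snd c \<circ> \<gamma>) has_vector_derivative F' (v c)) (at t)"
      by (simp add: has_vector_derivative_def)
    have inv: "chart_inv c (snd c q) = q" if "q \<in> fst c" for q
      using is_chart_inv[OF M.charts_at_is_chart[OF c] that] .
    have "eventually (\<lambda>s. \<gamma> s \<in> fst c) (at t)"
      using lim M.charts_at_openin[OF c] M.charts_at_mem[OF c] by (auto simp: limitin_def)
    then have "eventually (\<lambda>s. (F \<circ> (snd c \<circ> \<gamma>)) s = (snd d \<circ> (\<lambda>s. f (\<gamma> s))) s) (at t)"
      by eventually_elim (simp add: F_def inv)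
    then have "((snd d \<circ> (\<lambda>s. f (\<gamma> s))) has_vector_derivative F' (v c)) (at t)"
      using D has_derivative_transform_eventually[of "F \<circ> (snd c \<circ> \<gamma>)" _ t UNIV]
        inv[OF M.charts_at_mem[OF c]]
      unfolding has_vector_derivative_def by (simp add: F_def)
    then show ?thesis
      by (simp add: tangent_map_apply[OF M f v c d] F'_def F_def)
  qed
  ultimately show ?thesis
    using tangent_map_in_tangent_space[OF M N f v p] by (auto simp: has_velocity_def)
qed

section \<open>Curves of zero velocity\<close>

definition zero_vector :: "('a, 'e::real_normed_vector) manifold \<Rightarrow> 'a \<Rightarrow> ('a, 'e) chart \<Rightarrow> 'e" where
  "zero_vector M p = restrict (\<lambda>_. 0) (charts_at M p)"

lemma (in smooth_manifold) zero_vector_in_tangent_space: "zero_vector M p \<in> tangent_space M p"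
  using differentiable_mapD[OF differentiable_map_ident] linear_frechet_derivative
  by (fastforce simp: zero_vector_def tangent_space_def comp_def linear_0)

lemma tangent_map_zero_vector:
  assumes M: "smooth_manifold M" and f: "differentiable_map M N f"
    and p: "p \<in> topspace (mtop M)"
  shows "tangent_map M N f p (zero_vector M p) = zero_vector N (f p)"
proof
  fix d
  interpret M: smooth_manifold M by fact
  obtain c where c: "c \<in> charts_at M p"
    using M.charts_at_nonempty[OF p] by blast
  show "tangent_map M N f p (zero_vector M p) d = zero_vector N (f p) d"
  proof (cases "d \<in> charts_at N (f p)")
    case True
    have "tangent_map M N f p (zero_vector M p) d =
          frechet_derivative (snd d \<circ> f \<circ> chart_inv c) (at (snd c p)) 0"
      using tangent_map_apply[OF M f M.zero_vector_in_tangent_space c True] c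
      by (simp add: zero_vector_def)
    also have "\<dots> = 0"
      using linear_frechet_derivative[OF differentiable_mapD[OF f c True]] by (rule linear_0)
    finally show ?thesis
      using True by (simp add: zero_vector_def)
  next
    case False
    then show ?thesis
      by (simp add: zero_vector_def tangent_map_def Let_def)
  qed
qed

context smooth_manifold
begin

lemma has_velocity_const:
  "p \<in> topspace (mtop M) \<Longrightarrow> has_velocity M (\<lambda>_. p) (zero_vector M p) t"
  using zero_vector_in_tangent_space
  by (auto simp: has_velocity_def zero_vector_def comp_def)

text \<open>
  In a chart around \<open>\<gamma> a\<close> the derivative vanishes at all times near \<open>a\<close>, because this chart is
  also a chart around the neighbouring points of the curve.  So \<open>\<gamma>\<close> is locally constant, and the
  real line is connected.
\<close>

lemma zero_velocity_imp_constant: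
  assumes vel: "\<And>t. has_velocity M \<gamma> (zero_vector M (\<gamma> t)) t"
  shows "\<gamma> s = \<gamma> t"
proof -
  have "eventually (\<lambda>b. \<gamma> a = \<gamma> b) (at a)" for a
  proof -
    have lim: "limitin (mtop M) \<gamma> (\<gamma> a) (at a)"
      using vel by (auto simp: has_velocity_def)
    obtain c where c: "c \<in> charts_at M (\<gamma> a)"
      using charts_at_nonempty[OF limitin_topspace[OF lim]] by blast
    have "eventually (\<lambda>b. \<gamma> b \<in> fst c) (at a)"
      using lim charts_at_openin[OF c] charts_at_mem[OF c] by (auto simp: limitin_def)
    then obtain r where r: "r > 0" "\<And>b. b \<noteq> a \<Longrightarrow> dist b a < r \<Longrightarrow> \<gamma> b \<in> fst c"
      by (auto simp: eventually_at)
    have in_c: "\<gamma> b \<in> fst c" if "b \<in> ball a r" for b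
      using r(2)[of b] that charts_at_mem[OF c] by (cases "b = a") (auto simp: dist_commute)
    have "((snd c \<circ> \<gamma>) has_vector_derivative 0) (at b within ball a r)" if b: "b \<in> ball a r" for b
    proof -
      have "c \<in> charts_at M (\<gamma> b)"
        using c in_c[OF b] by (simp add: charts_at_def)
      then have "((snd c \<circ> \<gamma>) has_vector_derivative 0) (at b)"
        using vel[of b] by (auto simp: has_velocity_def zero_vector_def)
      then show ?thesis
        by (rule has_vector_derivative_at_within)
    qed
    then obtain k where k: "\<And>b. b \<in> ball a r \<Longrightarrow> (snd c \<circ> \<gamma>) b = k"
      using has_vector_derivative_zero_constant[of "ball a r" "snd c \<circ> \<gamma>"] convex_ball by blast
    have "\<gamma> a = \<gamma> b" if b: "b \<in> ball a r" for b
    proof -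
      have "a \<in> ball a r"
        using r(1) by simp
      then show ?thesis
        using inj_onD[OF is_chart_inj_on[OF charts_at_is_chart[OF c]], of "\<gamma> a" "\<gamma> b"]
          in_c k b by (metis comp_apply)
    qed
    then show ?thesis
      using r(1) unfolding eventually_at by (intro exI[of _ r]) (auto simp: dist_commute)
  qed
  then show ?thesis
    using connected_local_const[of "UNIV :: real set" s t \<gamma>] connected_UNIV by blast
qed

end

section \<open>Left translations as symmetries of the system\<close>

context lie_group
begin

lemma smooth_manifold_L: "smooth_manifold L"
  by (rule smooth_manifold_axioms)

text \<open>
  In the charts \<open>a\<close> around \<open>Z\<close> and \<open>c\<close> around \<open>X\<close>, left translation by \<open>Z\<close> is the multiplication
  with its first coordinate fixed at \<open>a(Z)\<close>.
\<close>

lemma differentiable_map_left_translation: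
  assumes Z: "Z \<in> carrier G"
  shows "differentiable_map L L (\<lambda>X. Z \<otimes> X)"
proof -
  have "continuous_map (mtop L) (prod_topology (mtop L) (mtop L)) (\<lambda>X. (Z, X))"
    using Z carrier_eq by (intro continuous_map_pairedI) auto
  moreover have "continuous_map (prod_topology (mtop L) (mtop L)) (mtop L) (\<lambda>(X, Y). X \<otimes> Y)"
    using smooth_mult by (auto simp: smooth_map_def prod_manifold_def)
  ultimately have "continuous_map (mtop L) (mtop L) ((\<lambda>(X, Y). X \<otimes> Y) \<circ> (\<lambda>X. (Z, X)))"
    by (rule continuous_map_compose)
  then have cont: "continuous_map (mtop L) (mtop L) (\<lambda>X. Z \<otimes> X)"
    by (simp add: comp_def)
  obtain a where a: "a \<in> charts_at L Z"
    using charts_at_nonempty[of Z] Z carrier_eq by auto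
  have "(snd d \<circ> (\<lambda>X. Z \<otimes> X) \<circ> chart_inv c) differentiable (at (snd c X))"
    if c: "c \<in> charts_at L X" and d: "d \<in> charts_at L (Z \<otimes> X)" for c d X
  proof -
    \<comment> \<open>The inverse of the product chart sends \<open>(a(Z), w)\<close> to \<open>(Z, c\<^sup>-\<^sup>1(w))\<close> for every
      \<open>w\<close> in the open image of \<open>c\<close>, so \<open>\<mu>(a(Z), _)\<close> is the translation near \<open>c(X)\<close>.\<close>
    define ac where "ac = (fst a \<times> fst c, map_prod (snd a) (snd c))"
    define \<mu> where "\<mu> = snd d \<circ> (\<lambda>(X, Y). X \<otimes> Y) \<circ> chart_inv ac"
    have "ac \<in> atlas (prod_manifold L L)"
      using a c by (fastforce simp: ac_def prod_manifold_def charts_at_def)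
    moreover have "d \<in> atlas L"
      using d by (simp add: charts_at_def)
    ultimately have "smooth_on (snd ac ` (fst ac \<inter> (\<lambda>(X, Y). X \<otimes> Y) -` fst d)) \<mu>"
      using smooth_mult by (simp add: smooth_map_def \<mu>_def)
    moreover have "(snd a Z, snd c X) \<in> snd ac ` (fst ac \<inter> (\<lambda>(X, Y). X \<otimes> Y) -` fst d)"
      using charts_at_mem[OF a] charts_at_mem[OF c] charts_at_mem[OF d]
      by (force simp: ac_def)
    ultimately have "\<mu> differentiable (at (snd a Z, snd c X))"
      by (rule smooth_on_differentiable)
    then obtain \<mu>' where \<mu>: "(\<mu> has_derivative \<mu>') (at (snd a Z, snd c X))"
      by (auto simp: differentiable_def)
    have "((\<lambda>w. (snd a Z, w)) has_derivative (\<lambda>w. (0, w))) (at (snd c X))"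
      by (intro derivative_intros)
    from diff_chain_at[OF this \<mu>]
    have D: "(\<mu> \<circ> (\<lambda>w. (snd a Z, w)) has_derivative \<mu>' \<circ> (\<lambda>w. (0, w))) (at (snd c X))" .
    have inj: "inj_on (snd ac) (fst ac)"
      using is_chart_inj_on[OF charts_at_is_chart[OF a]] is_chart_inj_on[OF charts_at_is_chart[OF c]]
      by (auto simp: ac_def inj_on_def)
    have eq: "(\<mu> \<circ> (\<lambda>w. (snd a Z, w))) w = (snd d \<circ> (\<lambda>X. Z \<otimes> X) \<circ> chart_inv c) w"
      if w: "w \<in> snd c ` fst c" for w
    proof -
      obtain q where q: "q \<in> fst c" "w = snd c q"
        using w by blast
      have "(Z, q) \<in> fst ac" "snd ac (Z, q) = (snd a Z, w)"
        using q charts_at_mem[OF a] by (auto simp: ac_def)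
      then have "chart_inv ac (snd a Z, w) = (Z, q)"
        using inv_into_f_f[OF inj] by metis
      then show ?thesis
        using q is_chart_inv[OF charts_at_is_chart[OF c] q(1)] by (simp add: \<mu>_def)
    qed
    have "open (snd c ` fst c)"
      using charts_at_is_chart[OF c] by (simp add: is_chart_def)
    then have "(snd d \<circ> (\<lambda>X. Z \<otimes> X) \<circ> chart_inv c has_derivative \<mu>' \<circ> (\<lambda>w. (0, w))) (at (snd c X))"
      using has_derivative_transform_within_open[OF D] eq charts_at_mem[OF c] by blast
    then show ?thesis
      by (auto simp: differentiable_def)
  qed
  then show ?thesis
    using cont by (auto simp: differentiable_map_def)
qed

text \<open>
  The tangent map at \<open>\<one>\<close> of \<open>L\<^sub>Z\<^sub>X = L\<^sub>Z \<circ> L\<^sub>X\<close>; the outer factor is taken at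
  \<open>L\<^sub>X \<one> = X\<close>.
\<close>

lemma left_translate_mult:
  assumes Z: "Z \<in> carrier G" and X: "X \<in> carrier G" and u: "u \<in> lie_algebra G L"
  shows "left_translate G L (Z \<otimes> X) u =
         tangent_map L L (\<lambda>Y. Z \<otimes> Y) X (left_translate G L X u)"
proof -
  have "tangent_map L L (\<lambda>Y. Z \<otimes> X \<otimes> Y) \<one> u =
        tangent_map L L (\<lambda>Y. Z \<otimes> Y) (X \<otimes> \<one>) (tangent_map L L (\<lambda>Y. X \<otimes> Y) \<one> u)"
    using X Z u
    by (intro tangent_map_compose smooth_manifold_L differentiable_map_left_translation)
      (auto simp: carrier_eq m_assoc lie_algebra_def)
  then show ?thesis
    using X by (simp add: left_translate_def)
qed

lemma is_solution_left_translation: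
  assumes Z: "Z \<in> carrier G" and u: "\<And>t. u t \<in> lie_algebra G L" and \<gamma>: "is_solution G L u \<gamma>"
  shows "is_solution G L u (\<lambda>t. Z \<otimes> \<gamma> t)"
  using has_velocity_map[OF smooth_manifold_L smooth_manifold_L differentiable_map_left_translation[OF Z]]
    \<gamma> Z u
  by (auto simp: is_solution_def left_translate_mult)

text \<open>
  Both sides are solutions for the same input, and at time 0 both are at \<open>X\<close>, since
  \<open>X Y\<^sup>-\<^sup>1 Y = X\<close>.
\<close>

lemma solutions_left_translates:
  assumes u: "admissible G L u" and X: "X \<in> carrier G" and Y: "Y \<in> carrier G"
    and \<gamma>: "is_solution G L u \<gamma>" "\<gamma> 0 = X" and \<delta>: "is_solution G L u \<delta>" "\<delta> 0 = Y"
  shows "\<gamma> t = X \<otimes> inv Y \<otimes> \<delta> t"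
proof -
  have "is_solution G L u (\<lambda>t. X \<otimes> inv Y \<otimes> \<delta> t)"
    using is_solution_left_translation[of "X \<otimes> inv Y" u \<delta>] u X Y \<delta>(1)
    by (simp add: admissible_def)
  moreover have "X \<otimes> inv Y \<otimes> \<delta> 0 = X"
    using X Y \<delta>(2) by (simp add: m_assoc)
  moreover have "\<exists>!\<gamma>. is_solution G L u \<gamma> \<and> \<gamma> 0 = X"
    using u X by (simp add: admissible_def)
  ultimately have "\<gamma> = (\<lambda>t. X \<otimes> inv Y \<otimes> \<delta> t)"
    using \<gamma> by blast
  then show ?thesis
    by meson
qed

section \<open>The zero input\<close>

lemma left_translate_zero:
  assumes X: "X \<in> carrier G"
  shows "left_translate G L X (zero_vector L \<one>) = zero_vector L X"
  using tangent_map_zero_vector[OF smooth_manifold_L differentiable_map_left_translation[OF X], of \<one>] X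
  by (simp add: left_translate_def carrier_eq)

lemma is_solution_zero_iff:
  "is_solution G L (\<lambda>_. zero_vector L \<one>) \<gamma> \<longleftrightarrow> (\<exists>X\<in>carrier G. \<gamma> = (\<lambda>_. X))"
proof
  assume sol: "is_solution G L (\<lambda>_. zero_vector L \<one>) \<gamma>"
  then have "has_velocity L \<gamma> (zero_vector L (\<gamma> t)) t" for t
    using left_translate_zero by (metis is_solution_def)
  then have "\<gamma> = (\<lambda>_. \<gamma> 0)"
    using zero_velocity_imp_constant by blast
  then show "\<exists>X\<in>carrier G. \<gamma> = (\<lambda>_. X)"
    using sol by (auto simp: is_solution_def)
next
  assume "\<exists>X\<in>carrier G. \<gamma> = (\<lambda>_. X)"
  then show "is_solution G L (\<lambda>_. zero_vector L \<one>) \<gamma>"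
    using has_velocity_const by (auto simp: is_solution_def left_translate_zero carrier_eq)
qed

lemma admissible_zero: "admissible G L (\<lambda>_. zero_vector L \<one>)"
  using zero_vector_in_tangent_space
  by (auto simp: admissible_def lie_algebra_def is_solution_zero_iff)

end

section \<open>Indistinguishable states\<close>

context smooth_transitive_right_action
begin

lemma indistinguishable_imp_same_output:
  assumes "X \<in> carrier G" "Y \<in> carrier G" "indistinguishable G L h y X Y"
  shows "h X y = h Y y"
proof -
  have "is_solution G L (\<lambda>_. zero_vector L \<one>) (\<lambda>_. X)"
    "is_solution G L (\<lambda>_. zero_vector L \<one>) (\<lambda>_. Y)"
    using assms by (auto simp: is_solution_zero_iff)
  then show ?thesis
    using assms(3) admissible_zero unfolding indistinguishable_def by blast
qed

lemma indistinguishable_iff: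
  assumes X: "X \<in> carrier G" and Y: "Y \<in> carrier G" and y: "y \<in> topspace (mtop M)"
  shows "indistinguishable G L h y X Y \<longleftrightarrow> X \<otimes> inv Y \<in> stabilizer G h y"
proof
  assume "indistinguishable G L h y X Y"
  then have "h X y = h Y y"
    using indistinguishable_imp_same_output X Y by blast
  then have "h (X \<otimes> inv Y) y = h (Y \<otimes> inv Y) y"
    using action_mult[of "inv Y" X y] action_mult[of "inv Y" Y y] X Y y by simp
  then show "X \<otimes> inv Y \<in> stabilizer G h y"
    using X Y y by (simp add: stabilizer_def action_one)
next
  assume stab: "X \<otimes> inv Y \<in> stabilizer G h y"
  have "h (\<gamma> t) y = h (\<delta> t) y"
    if "admissible G L u" "is_solution G L u \<gamma>" "\<gamma> 0 = X" "is_solution G L u \<delta>" "\<delta> 0 = Y" for u \<gamma> \<delta> t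
  proof -
    have "\<delta> t \<in> carrier G"
      using that by (simp add: is_solution_def)
    have "h (\<gamma> t) y = h (X \<otimes> inv Y \<otimes> \<delta> t) y"
      using solutions_left_translates that X Y by metis
    also have "\<dots> = h (\<delta> t) (h (X \<otimes> inv Y) y)"
      using action_mult \<open>\<delta> t \<in> carrier G\<close> X Y y by simp
    also have "h (X \<otimes> inv Y) y = y"
      using stab by (simp add: stabilizer_def)
    finally show ?thesis .
  qed
  then show "indistinguishable G L h y X Y"
    unfolding indistinguishable_def by blast
qed

end

theorem corollary6:
  fixes G :: "('g, 'z) monoid_scheme" (structure)
    and L :: "('g, 'e::real_normed_vector) manifold"
    and M :: "('m, 'f::real_normed_vector) manifold"
    and h :: "'g \<Rightarrow> 'm \<Rightarrow> 'm"
    and y\<^sub>0 :: 'm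
  assumes "lie_group G L"
    and "connected_space (mtop L)"
    and "smooth_manifold M"
    and "connected_space (mtop M)"
    and "smooth_transitive_right_action G L M h"
    and "y\<^sub>0 \<in> topspace (mtop M)"
  shows "(\<forall>X\<in>carrier G. \<forall>Y\<in>carrier G.
            indistinguishable G L h y\<^sub>0 X Y \<longleftrightarrow> X \<otimes> inv Y \<in> stabilizer G h y\<^sub>0) \<and>
         (\<forall>X\<in>carrier G.
            indistinguishable G L h y\<^sub>0 X \<one> \<longleftrightarrow> X \<in> stabilizer G h y\<^sub>0)"
proof -
  interpret smooth_transitive_right_action G L M h by fact
  show ?thesis
    using indistinguishable_iff \<open>y\<^sub>0 \<in> topspace (mtop M)\<close> by auto
qed

end
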